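(* Let $n\ge 1$ and $d\ge 1$ be integers, and let $\alpha,\beta\in\mathbb{N}^n$ with $|\alpha|\le d$ and $|\beta|\le d$. The pair $(\alpha,\beta)$ is a congenital zero for $d$-moments if and only if the least common multiple $X^\eta$ of the monomials $X^\alpha$ and $X^\beta$ has degree bigger than $d$ (that is, $\sum_{j=1}^n\max(\alpha_j,\beta_j)>d$).
   Context: $\mathbb{N}$ denotes the nonnegative integers; for $\alpha\in\mathbb{N}^n$, $|\alpha|=\alpha_1+\cdots+\alpha_n$ and $X^\alpha=X_1^{\alpha_1}\cdots X_n^{\alpha_n}$. For a real multi-sequence $y=(y_\alpha)_{\alpha\in\mathbb{N}^n}$, $L_y:\mathbb{R}[X]\to\mathbb{R}$ is the linear functional with $L_y(X^\alpha)=y_\alpha$. The moment matrix $M_d(y)$ is the real symmetric matrix with rows and columns indexed by $\{\alpha\in\mathbb{N}^n:|\alpha|\le d\}$ and entries $M_d(y)(\alpha,\beta)=L_y(X^\alpha X^\beta)=y_{\alpha+\beta}$. $M_d(y)\succ0$ means positive definite. A moment matrix $M_d(y)\succ 0$ has the product form property if $L_y(X^\alpha)=\prod_{i=1}^n L_y(X_i^{\alpha_i})$ for all $\alpha\in\mathbb{N}^n$ with $|\alpha|\le 2d$. The pair $(\alpha,\beta)$ is a congenital zero for $d$-moments if $M_d(y)^{-1}(\alpha,\beta)=0$ for every $y$ such that $M_d(y)\succ0$ has the product form property. *)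

theory Defs
  imports "HOL-Analysis.Finite_Cartesian_Product" "HOL-Library.Poly_Mapping"
begin

text \<open>
  Multi-indices are vectors \<open>nat ^ 'n\<close> with \<open>n = CARD('n)\<close>; since types are
  nonempty, \<open>n \<ge> 1\<close>.  The polynomial ring in the variables \<open>Xvar i\<close> is the monoid algebra of
  \<open>nat ^ 'n\<close> over the reals, whose product in \<open>Poly_Mapping\<close> is convolution.
\<close>

type_synonym 'n mpoly = "(nat ^ 'n) \<Rightarrow>\<^sub>0 real"

definition deg :: "nat ^ 'n \<Rightarrow> nat" where
  "deg \<alpha> = (\<Sum>j\<in>UNIV. \<alpha> $ j)"

definition Xpow :: "nat ^ 'n::finite \<Rightarrow> 'n mpoly" where
  "Xpow \<alpha> = Poly_Mapping.single \<alpha> 1"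

definition Xvar :: "'n::finite \<Rightarrow> 'n mpoly" where
  "Xvar i = Xpow (axis i 1)"

definition lcm_exp :: "nat ^ 'n \<Rightarrow> nat ^ 'n \<Rightarrow> nat ^ 'n" where
  "lcm_exp \<alpha> \<beta> = (\<chi> j. max (\<alpha> $ j) (\<beta> $ j))"

definition Lfun :: "(nat ^ 'n::finite \<Rightarrow> real) \<Rightarrow> 'n mpoly \<Rightarrow> real" where
  "Lfun y p = (\<Sum>\<alpha>\<in>Poly_Mapping.keys p. Poly_Mapping.lookup p \<alpha> * y \<alpha>)"

lemma Xpow_add: "Xpow \<alpha> * Xpow \<beta> = Xpow (\<alpha> + \<beta>)"
  by (simp add: Xpow_def mult_single)

lemma Xpow_eq_prod:
  fixes \<alpha> :: "nat ^ 'n"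
  shows "Xpow \<alpha> = (\<Prod>i\<in>UNIV. Xvar i ^ (\<alpha> $ i))"
proof -
  have p: "Xvar i ^ k = Xpow (axis i k)" for i :: 'n and k
  proof (induction k)
    case 0
    have "axis i 0 = (0 :: nat ^ 'n)" by (simp add: axis_def vec_eq_iff)
    then show ?case by (simp only: Xpow_def single_one power_0)
  next
    case (Suc k)
    have "axis i 1 + axis i k = axis i (Suc k)" by (simp add: axis_def vec_eq_iff)
    with Suc show ?case by (simp add: Xvar_def Xpow_add)
  qed
  have q: "(\<Prod>i\<in>A. Xpow (f i)) = Xpow (\<Sum>i\<in>A. f i)" if "finite A" for A and f :: "'n \<Rightarrow> nat ^ 'n"
    using that by induction (simp_all add: Xpow_add, simp add: Xpow_def single_one)
  have "(\<Sum>i\<in>UNIV. axis i (\<alpha> $ i)) = \<alpha>"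
    by (simp add: vec_eq_iff axis_def)
  then show ?thesis by (simp add: p q)
qed

lemma Lfun_Xpow: "Lfun y (Xpow \<alpha>) = y \<alpha>"
  by (simp add: Lfun_def Xpow_def)

lemma Lfun_add: "Lfun y (p + q) = Lfun y p + Lfun y q"
proof -
  let ?K = "Poly_Mapping.keys p \<union> Poly_Mapping.keys q"
  have *: "Lfun y r = (\<Sum>\<alpha>\<in>?K. Poly_Mapping.lookup r \<alpha> * y \<alpha>)"
    if "Poly_Mapping.keys r \<subseteq> ?K" for r
    unfolding Lfun_def using that by (intro sum.mono_neutral_left) (auto simp: in_keys_iff)
  show ?thesis
    using *[of p] *[of q] *[of "p + q"] keys_add[of p q]
    by (simp add: lookup_add distrib_right sum.distrib)
qed

lemma Xpow_lcm_dvd: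
  shows "Xpow \<alpha> dvd Xpow (lcm_exp \<alpha> \<beta>)" and "Xpow \<beta> dvd Xpow (lcm_exp \<alpha> \<beta>)"
proof -
  have "lcm_exp \<alpha> \<beta> = \<alpha> + (\<chi> j. lcm_exp \<alpha> \<beta> $ j - \<alpha> $ j)"
       "lcm_exp \<alpha> \<beta> = \<beta> + (\<chi> j. lcm_exp \<alpha> \<beta> $ j - \<beta> $ j)"
    by (auto simp: vec_eq_iff lcm_exp_def)
  then show "Xpow \<alpha> dvd Xpow (lcm_exp \<alpha> \<beta>)" "Xpow \<beta> dvd Xpow (lcm_exp \<alpha> \<beta>)"
    by (metis Xpow_add dvd_triv_left)+
qed

lemma Xpow_lcm_least:
  assumes "Xpow \<alpha> dvd p" and "Xpow \<beta> dvd p"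
  shows "Xpow (lcm_exp \<alpha> \<beta>) dvd p"
proof -
  have le: "\<gamma> $ j \<le> \<delta> $ j" if dv: "Xpow \<gamma> dvd p" and k: "\<delta> \<in> Poly_Mapping.keys p" for \<gamma> \<delta> j
  proof -
    from dv obtain q where "p = Xpow \<gamma> * q" by (auto simp: dvd_def)
    with k have "\<delta> \<in> {a + b |a b. a \<in> Poly_Mapping.keys (Xpow \<gamma>) \<and> b \<in> Poly_Mapping.keys q}"
      using keys_mult[of "Xpow \<gamma>" q] by auto
    then show ?thesis by (auto simp: Xpow_def)
  qed
  have "Xpow (lcm_exp \<alpha> \<beta>) dvd Poly_Mapping.single \<delta> c"
    if k: "\<delta> \<in> Poly_Mapping.keys p" for \<delta> c
  proof -
    have "lcm_exp \<alpha> \<beta> + (\<chi> j. \<delta> $ j - lcm_exp \<alpha> \<beta> $ j) = \<delta>"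
      using le[OF assms(1) k] le[OF assms(2) k] by (auto simp: vec_eq_iff lcm_exp_def)
    then have "Poly_Mapping.single \<delta> c
        = Xpow (lcm_exp \<alpha> \<beta>) * Poly_Mapping.single (\<chi> j. \<delta> $ j - lcm_exp \<alpha> \<beta> $ j) c"
      by (simp add: Xpow_def mult_single)
    then show ?thesis by simp
  qed
  then have "Xpow (lcm_exp \<alpha> \<beta>) dvd
      (\<Sum>\<delta>\<in>Poly_Mapping.keys p. Poly_Mapping.single \<delta> (Poly_Mapping.lookup p \<delta>))"
    by (intro dvd_sum) auto
  moreover have "(\<Sum>\<delta>\<in>Poly_Mapping.keys p. Poly_Mapping.single \<delta> (Poly_Mapping.lookup p \<delta>)) = p"
    by (rule poly_mapping_eqI) (auto simp: lookup_sum lookup_single when_def in_keys_iff)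
  ultimately show ?thesis by simp
qed

text \<open>
  A matrix with rows and columns indexed by a finite set \<open>I\<close> is a function of two arguments of
  which only the values on \<open>I \<times> I\<close> matter.
\<close>

definition pos_def_on :: "'i set \<Rightarrow> ('i \<Rightarrow> 'i \<Rightarrow> real) \<Rightarrow> bool" where
  "pos_def_on I M \<longleftrightarrow>
     (\<forall>i\<in>I. \<forall>j\<in>I. M i j = M j i) \<and>
     (\<forall>v. (\<exists>i\<in>I. v i \<noteq> 0) \<longrightarrow> (\<Sum>i\<in>I. \<Sum>j\<in>I. v i * M i j * v j) > 0)"

definition is_inverse_on :: "'i set \<Rightarrow> ('i \<Rightarrow> 'i \<Rightarrow> real) \<Rightarrow> ('i \<Rightarrow> 'i \<Rightarrow> real) \<Rightarrow> bool" where
  "is_inverse_on I M N \<longleftrightarrow>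
     (\<forall>i\<in>I. \<forall>j\<in>I. (\<Sum>k\<in>I. M i k * N k j) = (if i = j then 1 else 0)) \<and>
     (\<forall>i\<in>I. \<forall>j\<in>I. (\<Sum>k\<in>I. N i k * M k j) = (if i = j then 1 else 0))"

text \<open>As with \<open>matrix_inv\<close>, the value is unspecified if \<open>M\<close> is singular; otherwise it is uniquely
  determined on \<open>I \<times> I\<close>.\<close>

definition inverse_on :: "'i set \<Rightarrow> ('i \<Rightarrow> 'i \<Rightarrow> real) \<Rightarrow> 'i \<Rightarrow> 'i \<Rightarrow> real" where
  "inverse_on I M = (SOME N. is_inverse_on I M N)"

definition indices :: "nat \<Rightarrow> (nat ^ 'n) set" where
  "indices d = {\<alpha>. deg \<alpha> \<le> d}"

lemma finite_indices: "finite (indices d :: (nat ^ 'n) set)"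
proof -
  have "vec_nth ` (indices d :: (nat ^ 'n) set) \<subseteq> Pi UNIV (\<lambda>_. {..d})"
  proof (clarsimp simp: indices_def)
    fix \<alpha> :: "nat ^ 'n" and j assume "deg \<alpha> \<le> d"
    moreover have "\<alpha> $ j \<le> deg \<alpha>" unfolding deg_def by (rule member_le_sum) auto
    ultimately show "\<alpha> $ j \<le> d" by simp
  qed
  moreover have "finite (Pi (UNIV :: 'n set) (\<lambda>_. {..d}))"
    using finite_PiE[of "UNIV :: 'n set" "\<lambda>_. {..d}"] by (simp add: PiE_def)
  ultimately show ?thesis
    by (meson finite_imageD finite_subset inj_on_def vec_nth_inject)
qed

definition moment_matrix :: "(nat ^ 'n \<Rightarrow> real) \<Rightarrow> nat ^ 'n \<Rightarrow> nat ^ 'n \<Rightarrow> real" where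
  "moment_matrix y \<alpha> \<beta> = Lfun y (Xpow \<alpha> * Xpow \<beta>)"

lemma moment_matrix_eq: "moment_matrix y \<alpha> \<beta> = y (\<alpha> + \<beta>)"
  by (simp add: moment_matrix_def Xpow_add Lfun_Xpow)

text \<open>The truncation order \<open>d\<close> of the moment matrix enters through the index set \<open>indices d\<close>.\<close>

definition moment_pos_def :: "nat \<Rightarrow> (nat ^ 'n \<Rightarrow> real) \<Rightarrow> bool" where
  "moment_pos_def d y \<longleftrightarrow> pos_def_on (indices d) (moment_matrix y)"

definition moment_inverse ::
  "nat \<Rightarrow> (nat ^ 'n \<Rightarrow> real) \<Rightarrow> nat ^ 'n \<Rightarrow> nat ^ 'n \<Rightarrow> real" where
  "moment_inverse d y = inverse_on (indices d) (moment_matrix y)"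

definition product_form :: "nat \<Rightarrow> (nat ^ 'n \<Rightarrow> real) \<Rightarrow> bool" where
  "product_form d y \<longleftrightarrow>
     (\<forall>\<alpha>. deg \<alpha> \<le> 2 * d \<longrightarrow> Lfun y (Xpow \<alpha>) = (\<Prod>i\<in>UNIV. Lfun y (Xvar i ^ (\<alpha> $ i))))"

definition congenital_zero :: "nat \<Rightarrow> nat ^ 'n \<Rightarrow> nat ^ 'n \<Rightarrow> bool" where
  "congenital_zero d \<alpha> \<beta> \<longleftrightarrow>
     (\<forall>y. moment_pos_def d y \<and> product_form d y \<longrightarrow> moment_inverse d y \<alpha> \<beta> = 0)"

end

theory Submission imports Defs begin

text \<open>
  If \<open>y\<close> has product form, Cholesky factors \<open>S i\<close> of the univariate moment matrices multiply to a
  factor of the moment matrix itself, so its inverse has the entries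
  \<open>\<Sum>\<mu>. T \<mu> \<alpha> * T \<mu> \<beta>\<close> with \<open>T = S\<^sup>-\<^sup>1\<close> and \<open>deg \<mu> \<le> d\<close>.  Triangularity kills every
  term in which \<open>\<mu>\<close> is not a multiple of the lcm of \<open>\<alpha>\<close> and \<open>\<beta>\<close>, hence all terms if the lcm has
  degree above \<open>d\<close>.  Otherwise take the moments \<open>\<gamma> \<mapsto> \<Prod>i. fact (\<gamma> $ i)\<close> of the product of exponential
  distributions: there \<open>T\<close> is given by the Laguerre polynomials, whose coefficients alternate in sign,
  so all terms have the sign of \<open>(- 1) ^ (deg \<alpha> + deg \<beta>)\<close> and the one for the lcm is nonzero.
\<close>

section \<open>Inverses and Gram factorizations of matrices on a finite index set\<close>

lemma is_inverse_on_transpose: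
  assumes "is_inverse_on I S T"
  shows "is_inverse_on I (\<lambda>i j. T j i) (\<lambda>i j. S j i)"
  using assms unfolding is_inverse_on_def by (auto simp: mult.commute)

lemma is_inverse_on_unique:
  assumes "finite I" "is_inverse_on I M N" "is_inverse_on I M N'" "i \<in> I" "j \<in> I"
  shows "N i j = N' i j"
proof -
  have "N i j = (\<Sum>k\<in>I. N i k * (if k = j then 1 else 0))"
    using assms by (simp add: if_distrib cong: if_cong)
  also have "\<dots> = (\<Sum>k\<in>I. N i k * (\<Sum>l\<in>I. M k l * N' l j))"
    using assms by (intro sum.cong) (auto simp: is_inverse_on_def)
  also have "\<dots> = (\<Sum>k\<in>I. \<Sum>l\<in>I. N i k * M k l * N' l j)"
    by (simp add: sum_distrib_left mult.assoc)
  also have "\<dots> = (\<Sum>l\<in>I. (\<Sum>k\<in>I. N i k * M k l) * N' l j)"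
    by (subst sum.swap) (simp add: sum_distrib_right)
  also have "\<dots> = (\<Sum>l\<in>I. (if i = l then 1 else 0) * N' l j)"
    using assms by (intro sum.cong) (auto simp: is_inverse_on_def)
  also have "\<dots> = N' i j"
    using assms by (simp add: if_distrib[where f = "\<lambda>x. x * _"] cong: if_cong)
  finally show ?thesis .
qed

text \<open>The choice made in \<open>inverse_on\<close> is harmless: two-sided inverses agree on I
  x I, so any exhibited one gives its values.\<close>

lemma inverse_on_eqI:
  assumes "finite I" "is_inverse_on I M N" "i \<in> I" "j \<in> I"
  shows "inverse_on I M i j = N i j"
proof -
  have "is_inverse_on I M (inverse_on I M)"
    unfolding inverse_on_def using someI[of "is_inverse_on I M" N] assms(2) by simp
  then show ?thesis
    by (rule is_inverse_on_unique[OF assms(1) _ assms(2-4)])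
qed

lemma is_inverse_on_apply:
  assumes "finite I" "is_inverse_on I S T" "i \<in> I"
  shows "(\<Sum>l\<in>I. S i l * (\<Sum>j\<in>I. T l j * v j)) = v i"
proof -
  have "(\<Sum>l\<in>I. S i l * (\<Sum>j\<in>I. T l j * v j)) = (\<Sum>j\<in>I. (\<Sum>l\<in>I. S i l * T l j) * v j)"
    by (simp add: sum_distrib_left sum_distrib_right mult.assoc) (rule sum.swap)
  also have "\<dots> = (\<Sum>j\<in>I. (if i = j then 1 else 0) * v j)"
    using assms by (intro sum.cong) (auto simp: is_inverse_on_def)
  also have "\<dots> = v i"
    using assms by (simp add: if_distrib[where f = "\<lambda>x. x * _"] cong: if_cong)
  finally show ?thesis .
qed

lemma is_inverse_on_sym: "is_inverse_on I S T \<Longrightarrow> is_inverse_on I T S"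
  unfolding is_inverse_on_def by blast

text \<open>M is S S^T, and S S^T T^T T collapses from the middle: first S^T T^T, then S T. The
  other order follows because both matrices are symmetric.\<close>

lemma is_inverse_on_gram:
  assumes fin: "finite I" and inv: "is_inverse_on I S T"
    and M: "\<And>i j. i \<in> I \<Longrightarrow> j \<in> I \<Longrightarrow> M i j = (\<Sum>l\<in>I. S i l * S j l)"
  shows "is_inverse_on I M (\<lambda>i j. \<Sum>l\<in>I. T l i * T l j)"
proof -
  have *: "(\<Sum>k\<in>I. M i k * (\<Sum>l\<in>I. T l k * T l j)) = (if i = j then 1 else 0)"
    if ij: "i \<in> I" "j \<in> I" for i j
  proof -
    have "(\<Sum>k\<in>I. M i k * (\<Sum>l\<in>I. T l k * T l j))
        = (\<Sum>k\<in>I. \<Sum>m\<in>I. S i m * S k m * (\<Sum>l\<in>I. T l k * T l j))"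
      using ij M by (simp add: sum_distrib_right)
    also have "\<dots> = (\<Sum>m\<in>I. S i m * (\<Sum>k\<in>I. S k m * (\<Sum>l\<in>I. T l k * T l j)))"
      by (subst sum.swap) (simp add: sum_distrib_left mult.assoc)
    also have "\<dots> = (\<Sum>m\<in>I. S i m * T m j)"
      using is_inverse_on_apply[OF fin is_inverse_on_sym[OF is_inverse_on_transpose[OF inv]], of _ "\<lambda>l. T l j"]
      by simp
    also have "\<dots> = (if i = j then 1 else 0)"
      using inv ij by (simp add: is_inverse_on_def)
    finally show ?thesis .
  qed
  have sym: "M i j = M j i" if "i \<in> I" "j \<in> I" for i j
    using M that by (simp add: mult.commute)
  have "(\<Sum>k\<in>I. (\<Sum>l\<in>I. T l i * T l k) * M k j) = (if i = j then 1 else 0)"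
    if ij: "i \<in> I" "j \<in> I" for i j
  proof -
    have "(\<Sum>k\<in>I. (\<Sum>l\<in>I. T l i * T l k) * M k j) = (\<Sum>k\<in>I. M j k * (\<Sum>l\<in>I. T l k * T l i))"
      using ij sym by (intro sum.cong) (auto simp: mult.commute)
    also have "\<dots> = (if i = j then 1 else 0)"
      using *[OF ij(2,1)] by auto
    finally show ?thesis .
  qed
  with * show ?thesis
    unfolding is_inverse_on_def by blast
qed

lemma gram_quadratic_form:
  fixes S :: "'i \<Rightarrow> 'l \<Rightarrow> real"
  shows "(\<Sum>i\<in>I. \<Sum>j\<in>I. v i * (\<Sum>l\<in>L. S i l * S j l) * v j) = (\<Sum>l\<in>L. (\<Sum>i\<in>I. S i l * v i)\<^sup>2)"
proof -
  have "(\<Sum>l\<in>L. (\<Sum>i\<in>I. S i l * v i)\<^sup>2) = (\<Sum>l\<in>L. \<Sum>i\<in>I. \<Sum>j\<in>I. S i l * v i * (S j l * v j))"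
    by (simp add: power2_eq_square sum_product)
  also have "\<dots> = (\<Sum>i\<in>I. \<Sum>l\<in>L. \<Sum>j\<in>I. S i l * v i * (S j l * v j))"
    by (rule sum.swap)
  also have "\<dots> = (\<Sum>i\<in>I. \<Sum>j\<in>I. \<Sum>l\<in>L. S i l * v i * (S j l * v j))"
    by (intro sum.cong refl sum.swap)
  finally show ?thesis
    by (simp add: sum_distrib_left sum_distrib_right mult_ac)
qed

text \<open>The quadratic form is |S^T v|^2. It vanishes only if S^T v = 0, and then v = T^T (S^T v)
  = 0.\<close>

lemma pos_def_on_gram:
  assumes fin: "finite I" and inv: "is_inverse_on I S T"
    and M: "\<And>i j. i \<in> I \<Longrightarrow> j \<in> I \<Longrightarrow> M i j = (\<Sum>l\<in>I. S i l * S j l)"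
  shows "pos_def_on I M"
proof -
  have "(\<Sum>i\<in>I. \<Sum>j\<in>I. v i * M i j * v j) > 0" if v: "i \<in> I" "v i \<noteq> 0" for v i
  proof -
    have eq: "(\<Sum>i\<in>I. \<Sum>j\<in>I. v i * M i j * v j) = (\<Sum>l\<in>I. (\<Sum>i\<in>I. S i l * v i)\<^sup>2)"
      using M by (simp flip: gram_quadratic_form)
    have "(\<Sum>l\<in>I. (\<Sum>i\<in>I. S i l * v i)\<^sup>2) \<noteq> 0"
    proof
      assume "(\<Sum>l\<in>I. (\<Sum>i\<in>I. S i l * v i)\<^sup>2) = 0"
      then have "\<And>l. l \<in> I \<Longrightarrow> (\<Sum>i\<in>I. S i l * v i) = 0"
        using fin by (simp add: sum_nonneg_eq_0_iff)
      with is_inverse_on_apply[OF fin is_inverse_on_transpose[OF inv] v(1), of v] v(2)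
      show False by simp
    qed
    then show ?thesis
      unfolding eq by (simp add: order.not_eq_order_implies_strict sum_nonneg)
  qed
  moreover have "M i j = M j i" if "i \<in> I" "j \<in> I" for i j
    using M that by (simp add: mult.commute)
  ultimately show ?thesis
    unfolding pos_def_on_def by blast
qed

text \<open>A vector on J is carried along \<open>f\<close> and extended by zero, which preserves
  the value of the form. This serves for leading blocks and for the one-variable blocks of the
  moment matrix.\<close>

lemma pos_def_on_reindex:
  assumes "pos_def_on I M" "finite I" "inj_on f J" "f ` J \<subseteq> I"
  shows "pos_def_on J (\<lambda>i j. M (f i) (f j))"
  unfolding pos_def_on_def
proof (intro conjI ballI allI impI)
  fix i j assume "i \<in> J" "j \<in> J"
  then show "M (f i) (f j) = M (f j) (f i)"
    using assms unfolding pos_def_on_def by blast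
next
  fix v :: "'b \<Rightarrow> real" assume "\<exists>i\<in>J. v i \<noteq> 0"
  define w where "w i = (if i \<in> f ` J then v (inv_into J f i) else 0)" for i
  have w: "w (f i) = v i" if "i \<in> J" for i
    using that assms(3) by (simp add: w_def)
  have "\<exists>i\<in>I. w i \<noteq> 0"
    using \<open>\<exists>i\<in>J. v i \<noteq> 0\<close> w assms(4) by (metis image_subset_iff)
  then have "0 < (\<Sum>i\<in>I. \<Sum>j\<in>I. w i * M i j * w j)"
    using assms(1) unfolding pos_def_on_def by blast
  also have "\<dots> = (\<Sum>i\<in>I. \<Sum>j\<in>f ` J. w i * M i j * w j)"
    using assms(2,4) by (intro sum.cong refl sum.mono_neutral_right) (auto simp: w_def)
  also have "\<dots> = (\<Sum>i\<in>f ` J. \<Sum>j\<in>f ` J. w i * M i j * w j)"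
    using assms(2,4) by (intro sum.mono_neutral_right) (auto simp: w_def)
  also have "\<dots> = (\<Sum>i\<in>J. \<Sum>j\<in>J. v i * M (f i) (f j) * v j)"
    using assms(3) w by (simp add: sum.reindex)
  finally show "0 < (\<Sum>i\<in>J. \<Sum>j\<in>J. v i * M (f i) (f j) * v j)" .
qed

section \<open>Cholesky factorization\<close>

text \<open>Induction on the size, bordering the factors by a last row. The inverse is built
  alongside, and triangularity is asked for all natural indices so that later uses carry no range
  conditions.\<close>

lemma cholesky:
  assumes "pos_def_on {..<n} (M :: nat \<Rightarrow> nat \<Rightarrow> real)"
  shows "\<exists>S T. is_inverse_on {..<n} S T \<and> (\<forall>i l. i < l \<longrightarrow> S i l = 0 \<and> T i l = 0) \<and>
           (\<forall>i<n. \<forall>j<n. M i j = (\<Sum>l<n. S i l * S j l))"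
  using assms
proof (induction n)
  case 0
  show ?case by (intro exI[of _ "\<lambda>_ _. 0"]) (simp add: is_inverse_on_def)
next
  case (Suc n)
  have "pos_def_on {..<n} M"
    using pos_def_on_reindex[OF Suc.prems, of id "{..<n}"] by auto
  from Suc.IH[OF this] obtain S T where inv: "is_inverse_on {..<n} S T"
    and low: "\<And>i l. i < l \<Longrightarrow> S i l = 0" "\<And>i l. i < l \<Longrightarrow> T i l = 0"
    and M: "\<And>i j. i < n \<Longrightarrow> j < n \<Longrightarrow> M i j = (\<Sum>l<n. S i l * S j l)"
    by auto
  have sym: "M i j = M j i" if "i < Suc n" "j < Suc n" for i j
    using Suc.prems that unfolding pos_def_on_def by auto
  \<comment> \<open>Forward substitution: \<open>c\<close> solves S c = last column of M, as the
    off-diagonal part of the new row of the factor must.\<close>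
  define c where "c l = (\<Sum>j<n. T l j * M j n)" for l
  have Sc: "(\<Sum>l<n. S i l * c l) = M i n" if "i < n" for i
    unfolding c_def using is_inverse_on_apply[OF _ inv, of i "\<lambda>j. M j n"] that by simp
  \<comment> \<open>\<open>(- u, 1)\<close> is the vector minimising the quadratic form of \<open>M\<close> among those with last entry 1;
    the minimum \<open>r\<close> is the Schur complement.\<close>
  define u where "u j = (\<Sum>l<n. c l * T l j)" for j
  have uS: "(\<Sum>i<n. S i l * u i) = c l" if "l < n" for l
    using is_inverse_on_apply[OF _ is_inverse_on_sym[OF is_inverse_on_transpose[OF inv]], of l c] that
    by (simp add: u_def mult.commute)
  define r where "r = M n n - (\<Sum>l<n. (c l)\<^sup>2)"
  have "r > 0"
  proof -
    define v where "v i = (if i = n then 1 else - u i)" for i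
    have "\<exists>i\<in>{..<Suc n}. v i \<noteq> 0"
      by (rule bexI[of _ n]) (simp_all add: v_def)
    then have "0 < (\<Sum>i<Suc n. \<Sum>j<Suc n. v i * M i j * v j)"
      using Suc.prems unfolding pos_def_on_def by blast
    \<comment> \<open>At (-u, 1) the pure term and each of the two cross terms equal |c|^2, so that
      M n n - |c|^2 = r remains.\<close>
    also have "\<dots> = (\<Sum>i<n. \<Sum>j<n. u i * M i j * u j) - (\<Sum>i<n. u i * M i n)
        - (\<Sum>j<n. M n j * u j) + M n n"
      by (simp add: v_def sum.distrib sum_negf sum_subtractf)
    also have "(\<Sum>j<n. M n j * u j) = (\<Sum>i<n. u i * M i n)"
      using sym by (intro sum.cong) (auto simp: mult.commute)
    also have "(\<Sum>i<n. u i * M i n) = (\<Sum>i<n. u i * (\<Sum>l<n. S i l * c l))"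
      using Sc by simp
    also have "\<dots> = (\<Sum>l<n. (\<Sum>i<n. S i l * u i) * c l)"
      by (simp add: sum_distrib_left sum_distrib_right mult_ac) (rule sum.swap)
    also have "\<dots> = (\<Sum>l<n. (c l)\<^sup>2)"
      using uS by (simp add: power2_eq_square)
    also have "(\<Sum>i<n. \<Sum>j<n. u i * M i j * u j) = (\<Sum>l<n. (\<Sum>i<n. S i l * u i)\<^sup>2)"
      using M by (simp flip: gram_quadratic_form)
    also have "\<dots> = (\<Sum>l<n. (c l)\<^sup>2)"
      using uS by simp
    finally show ?thesis by (simp add: r_def)
  qed
  define s where "s = sqrt r"
  have s: "s > 0" "s * s = r"
    using \<open>r > 0\<close> by (auto simp: s_def)
  \<comment> \<open>In block form the new factor is [[S, 0], [c^T, s]]; its inverse is [[T, 0],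
    [-c^T T / s, 1 / s]], and \<open>u\<close> is c^T T.\<close>
  define S' where "S' i l = (if i = n then if l < n then c l else if l = n then s else 0
     else if l = n then 0 else S i l)" for i l
  define T' where "T' i l = (if i = n then if l < n then - u l / s else if l = n then 1 / s else 0
     else if l = n then 0 else T i l)" for i l
  have ST: "(\<Sum>l<n. S i l * T l j) = (if i = j then 1 else 0)"
    "(\<Sum>l<n. T i l * S l j) = (if i = j then 1 else 0)" if "i < n" "j < n" for i j
    using inv that unfolding is_inverse_on_def by auto
  have "is_inverse_on {..<Suc n} S' T'"
    using s(1) ST uS unfolding is_inverse_on_def
    by (auto simp: S'_def T'_def less_Suc_eq u_def[symmetric] sum_negf mult.commute
        sum_divide_distrib[symmetric])
  moreover have "S' i l = 0 \<and> T' i l = 0" if "i < l" for i l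
    using that low by (auto simp: S'_def T'_def)
  moreover have "M i j = (\<Sum>l<Suc n. S' i l * S' j l)" if ij: "i < Suc n" "j < Suc n" for i j
  proof -
    have nn: "(\<Sum>l<n. c l * c l) + s * s = M n n"
      unfolding s by (simp add: r_def power2_eq_square)
    consider "i < n" "j < n" | "i < n" "j = n" | "i = n" "j < n" | "i = n" "j = n"
      using ij by linarith
    then show ?thesis
    proof cases
      case 1
      then show ?thesis using M by (simp add: S'_def)
    next
      case 2
      then show ?thesis using Sc by (simp add: S'_def)
    next
      case 3
      then have "M i j = M j n" using sym by simp
      with 3 show ?thesis using Sc[of j] by (simp add: S'_def mult.commute)
    next
      case 4
      with nn show ?thesis by (simp add: S'_def)
    qed
  qed
  ultimately show ?case by blast
qed

section \<open>Coordinatewise products of triangular factors\<close>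

lemma nth_le_of_indices:
  assumes "\<alpha> \<in> indices d"
  shows "\<alpha> $ i \<le> d"
proof -
  have "\<alpha> $ i \<le> deg \<alpha>"
    unfolding deg_def by (rule member_le_sum) auto
  with assms show ?thesis by (simp add: indices_def)
qed

text \<open>Expanding the product gives a sum over the box of exponents up to d in each coordinate.
  A box point of degree above d exceeds \<alpha> in some coordinate, so its term vanishes. Thus
  triangularity reconciles the product structure with truncation by total degree.\<close>

lemma sum_indices_prod:
  fixes f :: "'n::finite \<Rightarrow> nat \<Rightarrow> real"
  assumes "deg \<alpha> \<le> d" and f: "\<And>i l. \<alpha> $ i < l \<Longrightarrow> f i l = 0"
  shows "(\<Sum>\<mu>\<in>indices d. \<Prod>i\<in>UNIV. f i (\<mu> $ i)) = (\<Prod>i\<in>UNIV. \<Sum>l<Suc d. f i l)"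
proof -
  let ?P = "PiE UNIV (\<lambda>_::'n. {..<Suc d})"
  have "(\<Prod>i\<in>UNIV. \<Sum>l<Suc d. f i l) = (\<Sum>g\<in>?P. \<Prod>i\<in>UNIV. f i (g i))"
    by (rule prod_sum_PiE) auto
  also have "\<dots> = (\<Sum>\<mu>\<in>vec_lambda ` ?P. \<Prod>i\<in>UNIV. f i (\<mu> $ i))"
    by (subst sum.reindex) (auto simp: inj_on_def vec_lambda_inject)
  also have "\<dots> = (\<Sum>\<mu>\<in>indices d. \<Prod>i\<in>UNIV. f i (\<mu> $ i))"
  proof (rule sum.mono_neutral_right)
    show "finite (vec_lambda ` ?P)"
      by (intro finite_imageI finite_PiE) auto
    show "indices d \<subseteq> vec_lambda ` ?P"
    proof
      fix \<mu> :: "nat ^ 'n" assume "\<mu> \<in> indices d"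
      then have "vec_nth \<mu> \<in> ?P" using nth_le_of_indices by (auto simp: less_Suc_eq_le)
      then show "\<mu> \<in> vec_lambda ` ?P" by (metis image_eqI vec_nth_inverse)
    qed
    show "\<forall>\<mu>\<in>vec_lambda ` ?P - indices d. (\<Prod>i\<in>UNIV. f i (\<mu> $ i)) = 0"
    proof
      fix \<mu> :: "nat ^ 'n" assume "\<mu> \<in> vec_lambda ` ?P - indices d"
      then have "deg \<alpha> < deg \<mu>" using assms(1) by (simp add: indices_def)
      then obtain i where "\<alpha> $ i < \<mu> $ i"
        unfolding deg_def by (metis linorder_not_le sum_mono)
      then show "(\<Prod>i\<in>UNIV. f i (\<mu> $ i)) = 0"
        using f by (intro prod_zero) auto
    qed
  qed
  finally show ?thesis by simp
qed

text \<open>Triangular Gram factorizations of the Hankel matrices \<open>m i (j + k)\<close>, one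
  per variable. Instances are the Cholesky factors of an arbitrary product form \<open>y\<close> and
  the explicit factors for factorial moments.\<close>

locale product_factorization =
  fixes d :: nat and y :: "nat ^ 'n::finite \<Rightarrow> real"
    and m :: "'n \<Rightarrow> nat \<Rightarrow> real" and S T :: "'n \<Rightarrow> nat \<Rightarrow> nat \<Rightarrow> real"
  assumes y_prod: "deg \<gamma> \<le> 2 * d \<Longrightarrow> y \<gamma> = (\<Prod>i\<in>UNIV. m i (\<gamma> $ i))"
    and inv: "is_inverse_on {..<Suc d} (S i) (T i)"
    and S_lower: "j < l \<Longrightarrow> S i j l = 0"
    and T_lower: "j < l \<Longrightarrow> T i j l = 0"
    and m_gram: "j \<le> d \<Longrightarrow> k \<le> d \<Longrightarrow> m i (j + k) = (\<Sum>l<Suc d. S i j l * S i k l)"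
begin

lemma is_inverse_on_indices:
  "is_inverse_on (indices d) (\<lambda>\<alpha> \<mu>. \<Prod>i\<in>UNIV. S i (\<alpha> $ i) (\<mu> $ i))
     (\<lambda>\<mu> \<beta>. \<Prod>i\<in>UNIV. T i (\<mu> $ i) (\<beta> $ i))"
proof -
  have le: "\<alpha> $ i < Suc d" if "\<alpha> \<in> indices d" for \<alpha> :: "nat ^ 'n" and i
    using nth_le_of_indices[OF that] by (simp add: less_Suc_eq_le)
  \<comment> \<open>General factors cover both S T and T S. Row \<alpha> of A vanishes beyond
    \<alpha>, as \<open>sum_indices_prod\<close> requires.\<close>
  have *: "(\<Sum>\<mu>\<in>indices d. (\<Prod>i\<in>UNIV. A i (\<alpha> $ i) (\<mu> $ i)) * (\<Prod>i\<in>UNIV. B i (\<mu> $ i) (\<beta> $ i)))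
      = (if \<alpha> = \<beta> then 1 else 0)"
    if "\<And>i. is_inverse_on {..<Suc d} (A i) (B i)" "\<And>i j l. j < l \<Longrightarrow> A i j l = 0"
      "\<alpha> \<in> indices d" "\<beta> \<in> indices d" for A B :: "'n \<Rightarrow> nat \<Rightarrow> nat \<Rightarrow> real" and \<alpha> \<beta>
  proof -
    have "(\<Sum>\<mu>\<in>indices d. (\<Prod>i\<in>UNIV. A i (\<alpha> $ i) (\<mu> $ i)) * (\<Prod>i\<in>UNIV. B i (\<mu> $ i) (\<beta> $ i)))
        = (\<Sum>\<mu>\<in>indices d. \<Prod>i\<in>UNIV. A i (\<alpha> $ i) (\<mu> $ i) * B i (\<mu> $ i) (\<beta> $ i))"
      by (simp add: prod.distrib)
    also have "\<dots> = (\<Prod>i\<in>UNIV. \<Sum>l<Suc d. A i (\<alpha> $ i) l * B i l (\<beta> $ i))"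
      by (rule sum_indices_prod[where f = "\<lambda>i l. A i (\<alpha> $ i) l * B i l (\<beta> $ i)"])
        (use that in \<open>auto simp: indices_def\<close>)
    also have "\<dots> = (\<Prod>i\<in>UNIV. if \<alpha> $ i = \<beta> $ i then 1 else 0)"
      using that(1) le[OF that(3)] le[OF that(4)]
      by (intro prod.cong) (auto simp: is_inverse_on_def simp del: sum.lessThan_Suc)
    also have "\<dots> = (if \<alpha> = \<beta> then 1 else 0)"
      by (auto simp: vec_eq_iff intro!: prod_zero)
    finally show ?thesis .
  qed
  show ?thesis
    unfolding is_inverse_on_def
    using *[of S T] *[of T S] inv is_inverse_on_sym[OF inv] S_lower T_lower by blast
qed

lemma moment_matrix_gram:
  assumes "\<alpha> \<in> indices d" "\<beta> \<in> indices d"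
  shows "moment_matrix y \<alpha> \<beta> = (\<Sum>\<mu>\<in>indices d.
    (\<Prod>i\<in>UNIV. S i (\<alpha> $ i) (\<mu> $ i)) * (\<Prod>i\<in>UNIV. S i (\<beta> $ i) (\<mu> $ i)))"
proof -
  have "deg (\<alpha> + \<beta>) \<le> 2 * d"
    using assms by (simp add: indices_def deg_def sum.distrib)
  then have "moment_matrix y \<alpha> \<beta> = (\<Prod>i\<in>UNIV. m i (\<alpha> $ i + \<beta> $ i))"
    by (simp add: moment_matrix_eq y_prod)
  also have "\<dots> = (\<Prod>i\<in>UNIV. \<Sum>l<Suc d. S i (\<alpha> $ i) l * S i (\<beta> $ i) l)"
    using assms by (simp add: nth_le_of_indices m_gram del: sum.lessThan_Suc)
  also have "\<dots> = (\<Sum>\<mu>\<in>indices d. \<Prod>i\<in>UNIV. S i (\<alpha> $ i) (\<mu> $ i) * S i (\<beta> $ i) (\<mu> $ i))"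
    by (rule sum_indices_prod[where f = "\<lambda>i l. S i (\<alpha> $ i) l * S i (\<beta> $ i) l", symmetric])
      (use assms S_lower in \<open>auto simp: indices_def\<close>)
  finally show ?thesis by (simp add: prod.distrib)
qed

lemma moment_pos_def: "moment_pos_def d y"
  unfolding moment_pos_def_def
  using finite_indices is_inverse_on_indices moment_matrix_gram by (rule pos_def_on_gram)

text \<open>The multivariate factors give M = S S^T, hence the inverse T^T T. As T is lower
  triangular, only \<mu> dominating both \<alpha> and \<beta> can contribute.\<close>

lemma moment_inverse_eq:
  assumes "\<alpha> \<in> indices d" "\<beta> \<in> indices d"
  shows "moment_inverse d y \<alpha> \<beta> =
    (\<Sum>\<mu>\<in>indices d. \<Prod>i\<in>UNIV. T i (\<mu> $ i) (\<alpha> $ i) * T i (\<mu> $ i) (\<beta> $ i))"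
  unfolding moment_inverse_def
  using inverse_on_eqI[OF finite_indices
      is_inverse_on_gram[OF finite_indices is_inverse_on_indices moment_matrix_gram] assms]
  by (simp add: prod.distrib)

end

section \<open>Factorizations of arbitrary product form sequences\<close>

lemma product_form_iff:
  fixes y :: "nat ^ 'n \<Rightarrow> real"
  shows "product_form d y \<longleftrightarrow> (\<forall>\<gamma>. deg \<gamma> \<le> 2 * d \<longrightarrow> y \<gamma> = (\<Prod>i\<in>UNIV. y (axis i (\<gamma> $ i))))"
proof -
  have "Xvar i ^ k = Xpow (axis i k)" for i :: 'n and k
    unfolding Xpow_eq_prod[of "axis i k"]
    by (subst prod.remove[of _ i]) (auto simp: axis_def)
  then show ?thesis
    by (simp add: product_form_def Lfun_Xpow)
qed

lemma deg_axis [simp]: "deg (axis i k) = k"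
  by (simp add: deg_def axis_def)

text \<open>The Hankel matrix of one variable is the principal submatrix of the moment matrix on the
  powers of that variable, hence positive definite, and \<open>cholesky\<close> applies.\<close>

lemma product_factorization_exists:
  fixes y :: "nat ^ 'n \<Rightarrow> real"
  assumes pd: "moment_pos_def d y" and pf: "product_form d y"
  shows "\<exists>m S T. product_factorization d y m S T"
proof -
  define m where "m i k = y (axis i k)" for i k
  define P where "P i S T \<longleftrightarrow> is_inverse_on {..<Suc d} S T \<and>
      (\<forall>j l. j < l \<longrightarrow> S j l = 0 \<and> T j l = 0) \<and>
      (\<forall>j<Suc d. \<forall>k<Suc d. m i (j + k) = (\<Sum>l<Suc d. S j l * S k l))" for i S T
  have ax: "axis i j + axis i k = (axis i (j + k) :: nat ^ 'n)" for i j k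
    by (simp add: axis_def vec_eq_iff)
  have "pos_def_on {..<Suc d} (\<lambda>j k. m i (j + k))" for i
  proof -
    have "pos_def_on {..<Suc d} (\<lambda>j k. moment_matrix y (axis i j) (axis i k))"
    proof (rule pos_def_on_reindex[OF _ finite_indices])
      show "pos_def_on (indices d) (moment_matrix y)"
        using pd by (simp add: moment_pos_def_def)
      show "inj_on (axis i :: nat \<Rightarrow> nat ^ 'n) {..<Suc d}"
        by (metis deg_axis inj_onI)
    qed (auto simp: indices_def)
    then show ?thesis by (simp add: moment_matrix_eq ax m_def)
  qed
  then have "\<exists>S T. P i S T" for i
    unfolding P_def by (rule cholesky)
  then obtain S T where "\<And>i. P i (S i) (T i)"
    by metis
  then have "\<And>i. is_inverse_on {..<Suc d} (S i) (T i)"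
    "\<And>i j l. j < l \<Longrightarrow> S i j l = 0" "\<And>i j l. j < l \<Longrightarrow> T i j l = 0"
    "\<And>i j k. j < Suc d \<Longrightarrow> k < Suc d \<Longrightarrow> m i (j + k) = (\<Sum>l<Suc d. S i j l * S i k l)"
    by (auto simp: P_def simp del: sum.lessThan_Suc)
  then have "product_factorization d y m S T"
    using pf by unfold_locales (auto simp: product_form_iff m_def simp del: sum.lessThan_Suc)
  then show ?thesis by blast
qed

section \<open>Explicit factors for factorial moments\<close>

text \<open>Binomial inversion: pulling out (j choose k) by the subset-of-a-subset identity leaves
  the alternating sum of binomials in row j - k, zero unless j = k.\<close>

lemma sum_signed_choose_mult:
  assumes "j \<le> d"
  shows "(\<Sum>l<Suc d. (- 1) ^ (l + k) * (real (j choose l) * real (l choose k))) = (if j = k then 1 else 0)"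
proof -
  have "(\<Sum>l<Suc d. (- 1) ^ (l + k) * (real (j choose l) * real (l choose k)))
      = (\<Sum>l\<in>{k..j}. (- 1) ^ (l + k) * (real (j choose l) * real (l choose k)))"
    using assms by (intro sum.mono_neutral_right) (auto simp: not_le)
  also have "\<dots> = (\<Sum>l\<in>{k..j}. real (j choose k) * ((- 1) ^ (l - k) * real ((j - k) choose (l - k))))"
  proof (intro sum.cong refl)
    fix l assume l: "l \<in> {k..j}"
    then have "(- 1 :: real) ^ (l + k) = (- 1) ^ (l - k)"
      by (simp add: minus_one_power_iff)
    moreover have "real (j choose l) * real (l choose k) = real (j choose k) * real ((j - k) choose (l - k))"
      using choose_mult[of k l j] l by (simp flip: of_nat_mult)
    ultimately show "(- 1) ^ (l + k) * (real (j choose l) * real (l choose k)) =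
        real (j choose k) * ((- 1) ^ (l - k) * real ((j - k) choose (l - k)))"
      by simp
  qed
  also have "\<dots> = (if j = k then 1 else 0)"
  proof (cases "k \<le> j")
    case True
    have "(\<Sum>l\<in>{k..j}. real (j choose k) * ((- 1) ^ (l - k) * real ((j - k) choose (l - k))))
        = real (j choose k) * (\<Sum>i\<le>j - k. (- 1) ^ i * real ((j - k) choose i))"
      unfolding sum_distrib_left
      by (rule sum.reindex_bij_witness[of _ "\<lambda>i. i + k" "\<lambda>l. l - k"]) (use True in auto)
    then show ?thesis
      using True choose_alternating_sum[of "j - k", where 'a = real] by (cases "j = k") auto
  qed simp
  finally show ?thesis .
qed

text \<open>Divided by \<open>fact j * fact k\<close>, this is Vandermonde's identity for (j + k)
  choose j.\<close>

lemma fact_add_eq_sum: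
  assumes "j \<le> d"
  shows "fact (j + k) = (\<Sum>l<Suc d. (fact j * real (j choose l)) * (fact k * real (k choose l)))"
proof -
  have "(\<Sum>l\<le>j. (j choose l) * (k choose l)) = (\<Sum>l\<le>j. (k choose l) * (j choose (j - l)))"
    by (intro sum.cong) (auto simp: binomial_symmetric[symmetric])
  also have "\<dots> = (j + k) choose j"
    using vandermonde[of k j j] by (simp add: add.commute)
  finally have v: "(\<Sum>l\<le>j. (j choose l) * (k choose l)) = (j + k) choose j" .
  have "(\<Sum>l<Suc d. (fact j * real (j choose l)) * (fact k * real (k choose l)))
      = (\<Sum>l\<le>j. fact j * fact k * real ((j choose l) * (k choose l)))"
    using assms by (intro sum.mono_neutral_cong_right) auto
  also have "\<dots> = fact j * fact k * real ((j + k) choose j)"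
    unfolding v[symmetric] by (simp add: sum_distrib_left)
  also have "\<dots> = fact (j + k)"
    by (simp add: binomial_fact)
  finally show ?thesis by simp
qed

text \<open>\<open>fact k\<close> is the k-th moment of the exponential distribution. Row l of the
  inverse factor holds the coefficients of (-1)^l times the Laguerre polynomial of degree l,
  orthonormal for it.\<close>

lemma product_factorization_factorial:
  "product_factorization d (\<lambda>\<gamma>. \<Prod>i\<in>(UNIV :: 'n::finite set). fact (\<gamma> $ i)) (\<lambda>_. fact)
     (\<lambda>_ j l. fact j * real (j choose l)) (\<lambda>_ l k. (- 1) ^ (l + k) * real (l choose k) / fact k)"
proof
  fix i :: 'n
  show "is_inverse_on {..<Suc d} (\<lambda>j l. fact j * real (j choose l))
      (\<lambda>l k. (- 1) ^ (l + k) * real (l choose k) / fact k)"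
    unfolding is_inverse_on_def
  proof (intro conjI ballI)
    fix j k assume "j \<in> {..<Suc d}" "k \<in> {..<Suc d}"
    then have j: "j \<le> d" by simp
    have "(\<Sum>l<Suc d. fact j * real (j choose l) * ((- 1) ^ (l + k) * real (l choose k) / fact k))
        = fact j / fact k * (\<Sum>l<Suc d. (- 1) ^ (l + k) * (real (j choose l) * real (l choose k)))"
      unfolding sum_distrib_left by (intro sum.cong) auto
    then show "(\<Sum>l<Suc d. fact j * real (j choose l) * ((- 1) ^ (l + k) * real (l choose k) / fact k))
        = (if j = k then 1 else 0)"
      unfolding sum_signed_choose_mult[OF j] by simp
    \<comment> \<open>Here \<open>fact l\<close> cancels, and (-1)^(j+l) = (-1)^(j+k) (-1)^(l+k)
      brings back the same inversion sum.\<close>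
    have "(\<Sum>l<Suc d. (- 1) ^ (j + l) * real (j choose l) / fact l * (fact l * real (l choose k)))
        = (- 1) ^ (j + k) * (\<Sum>l<Suc d. (- 1) ^ (l + k) * (real (j choose l) * real (l choose k)))"
      unfolding sum_distrib_left
      by (intro sum.cong) (auto simp: minus_one_power_iff)
    then show "(\<Sum>l<Suc d. (- 1) ^ (j + l) * real (j choose l) / fact l * (fact l * real (l choose k)))
        = (if j = k then 1 else 0)"
      unfolding sum_signed_choose_mult[OF j] by (simp add: minus_one_power_iff)
  qed
qed (use fact_add_eq_sum in auto)

section \<open>Congenital zeros and the degree of the lcm\<close>

theorem theorem3p1:
  fixes \<alpha> \<beta> :: "nat ^ 'n" and d :: nat
  assumes "d \<ge> 1" and "deg \<alpha> \<le> d" and "deg \<beta> \<le> d"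
  shows "congenital_zero d \<alpha> \<beta> \<longleftrightarrow> deg (lcm_exp \<alpha> \<beta>) > d"
proof
  have I: "\<alpha> \<in> indices d" "\<beta> \<in> indices d"
    using assms by (simp_all add: indices_def)
  show "congenital_zero d \<alpha> \<beta>" if lcm: "deg (lcm_exp \<alpha> \<beta>) > d"
    unfolding congenital_zero_def
  proof (intro allI impI, elim conjE)
    fix y :: "nat ^ 'n \<Rightarrow> real"
    assume "moment_pos_def d y" "product_form d y"
    then obtain m S T where "product_factorization d y m S T"
      using product_factorization_exists by blast
    then interpret product_factorization d y m S T .
    \<comment> \<open>In a coordinate where \<mu> falls short of the lcm it is below \<alpha> or
      \<beta>, so one of the two entries of T vanishes.\<close>
    have "(\<Prod>i\<in>UNIV. T i (\<mu> $ i) (\<alpha> $ i) * T i (\<mu> $ i) (\<beta> $ i)) = 0"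
      if "\<mu> \<in> indices d" for \<mu>
    proof -
      have "deg \<mu> < deg (lcm_exp \<alpha> \<beta>)"
        using that lcm by (simp add: indices_def)
      then obtain i where "\<mu> $ i < lcm_exp \<alpha> \<beta> $ i"
        unfolding deg_def by (metis linorder_not_le sum_mono)
      then have "T i (\<mu> $ i) (\<alpha> $ i) * T i (\<mu> $ i) (\<beta> $ i) = 0"
        using T_lower by (auto simp: lcm_exp_def less_max_iff_disj)
      then show ?thesis by (intro prod_zero) auto
    qed
    then show "moment_inverse d y \<alpha> \<beta> = 0"
      unfolding moment_inverse_eq[OF I] by (intro sum.neutral ballI)
  qed
  show "deg (lcm_exp \<alpha> \<beta>) > d" if cz: "congenital_zero d \<alpha> \<beta>"
  proof (rule ccontr)
    assume "\<not> deg (lcm_exp \<alpha> \<beta>) > d"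
    then have L: "lcm_exp \<alpha> \<beta> \<in> indices d" by (simp add: indices_def)
    define y where "y \<gamma> = (\<Prod>i\<in>UNIV. fact (\<gamma> $ i) :: real)" for \<gamma> :: "nat ^ 'n"
    define T where "T l k = (- 1) ^ (l + k) * real (l choose k) / fact k" for l k
    interpret product_factorization d y "\<lambda>_. fact" "\<lambda>_ j l. fact j * real (j choose l)" "\<lambda>_. T"
      unfolding y_def[abs_def] T_def[abs_def] by (rule product_factorization_factorial)
    \<comment> \<open>The other coordinates contribute fact 0 = 1.\<close>
    have "y (axis i k) = fact k" for i k
      unfolding y_def by (subst prod.remove[of _ i]) (auto simp: axis_def)
    then have "product_form d y"
      by (simp add: product_form_iff y_def)
    with cz moment_pos_def have "moment_inverse d y \<alpha> \<beta> = 0"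
      unfolding congenital_zero_def by blast
    \<comment> \<open>\<open>w\<close> is the \<mu>-term of the inverse entry stripped of its
      sign.\<close>
    define w where "w \<mu> = (\<Prod>i\<in>UNIV. (real (\<mu> $ i choose \<alpha> $ i) / fact (\<alpha> $ i))
      * (real (\<mu> $ i choose \<beta> $ i) / fact (\<beta> $ i)))" for \<mu> :: "nat ^ 'n"
    define \<sigma> where "\<sigma> = (\<Prod>i\<in>(UNIV :: 'n set). (- 1 :: real) ^ (\<alpha> $ i + \<beta> $ i))"
    \<comment> \<open>The sign of the row index l occurs twice and cancels, so the sign is
      independent of \<mu> and factors out as \<sigma>.\<close>
    have T: "T l j * T l k = (- 1) ^ (j + k) * ((real (l choose j) / fact j) * (real (l choose k) / fact k))"
      for l j k
      by (simp add: T_def minus_one_power_iff)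
    have "moment_inverse d y \<alpha> \<beta> = \<sigma> * (\<Sum>\<mu>\<in>indices d. w \<mu>)"
      unfolding moment_inverse_eq[OF I] T w_def \<sigma>_def prod.distrib sum_distrib_left ..
    moreover have "\<sigma> \<noteq> 0" by (simp add: \<sigma>_def)
    moreover have "(\<Sum>\<mu>\<in>indices d. w \<mu>) > 0"
    proof (rule sum_pos2[OF finite_indices L])
      \<comment> \<open>The lcm dominates \<alpha> and \<beta>, so all its binomials are
        positive.\<close>
      show "w (lcm_exp \<alpha> \<beta>) > 0"
        unfolding w_def by (intro prod_pos) (auto simp: lcm_exp_def)
      show "w \<mu> \<ge> 0" for \<mu>
        unfolding w_def by (intro prod_nonneg) auto
    qed
    ultimately show False
      using \<open>moment_inverse d y \<alpha> \<beta> = 0\<close> by simp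
  qed
qed

end
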